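(* Let $\mathbf{V}=\{V^n\}_{n=1}^\infty$ be a general source and $\mathbf{W}=\{W^n\}_{n=1}^\infty$ a general channel, and suppose that either the source $\mathbf{V}$ or the channel $\mathbf{W}$ satisfies the strong converse property. Then the following two statements hold: 1) If $R_f(\mathbf{V})<C(\mathbf{W})$, then the source $\mathbf{V}$ is transmissible over the channel $\mathbf{W}$. In this case, the source coding and the channel coding can be separated (that is, transmissibility is achieved by two-step encoding). 2) If the source $\mathbf{V}$ is transmissible over the channel $\mathbf{W}$, then $R_f(\mathbf{V})\le C(\mathbf{W})$.
   Context: A general source $\mathbf{V}=\{V^n\}_{n=1}^\infty$ is an arbitrary sequence of random variables $V^n=(V_1^{(n)},\dots,V_n^{(n)})$ with values in $\mathcal{V}^n$, where the source alphabet $\mathcal{V}$ is a countably infinite set; no consistency between different $n$ is required. A general channel $\mathbf{W}=\{W^n(\cdot|\cdot):\mathcal{X}^n\to\mathcal{Y}^n\}_{n=1}^\infty$ is an arbitrary sequence of transition probabilities (Markov kernels) $W^n$ from $\mathcal{X}^n$ to $\mathcal{Y}^n$, where $\mathcal{X},\mathcal{Y}$ are arbitrary abstract (measurable) alphabets. Logarithms are natural. Transmissibility: a joint source-channel $(n,\varepsilon_n)$ code is a pair of an encoder $\varphi_n:\mathcal{V}^n\to\mathcal{X}^n$ and a decoder $\psi_n:\mathcal{Y}^n\to\mathcal{V}^n$ (deterministic maps) whose probability of decoding error is $\varepsilon_n=\sum_{\mathbf{v}\in\mathcal{V}^n}P_{V^n}(\mathbf{v})\,W^n(\mathcal{D}^c(\mathbf{v})|\varphi_n(\mathbf{v}))$,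 where $\mathcal{D}(\mathbf{v})=\{\mathbf{y}\in\mathcal{Y}^n:\psi_n(\mathbf{y})=\mathbf{v}\}$. $\mathbf{V}$ is transmissible over $\mathbf{W}$ if there exists a sequence of $(n,\varepsilon_n)$ codes with $\lim_{n\to\infty}\varepsilon_n=0$. Source coding: a fixed-length source code with $M_n$ codewords is a pair of maps $f_n:\mathcal{V}^n\to\{1,\dots,M_n\}$, $g_n:\{1,\dots,M_n\}\to\mathcal{V}^n$, with error probability $\Pr\{g_n(f_n(V^n))\ne V^n\}$. A rate $R$ is achievable if there are such codes with error probability tending to $0$ and $\limsup_{n\to\infty}\frac1n\log M_n\le R$; $R_f(\mathbf{V})$ is the infimum of all achievable rates. The source $\mathbf{V}$ satisfies the strong converse property if for every $R<R_f(\mathbf{V})$ every sequence of fixed-length source codes with $\limsup_{n\to\infty}\frac1n\log M_n\le R$ has error probability tending to $1$ as $n\to\infty$. Channel coding: a channel code with $M_n$ messages is a pair of maps $e_n:\{1,\dots,M_n\}\to\mathcal{X}^n$, $d_n:\mathcal{Y}^n\to\{1,\dots,M_n\}$, with (average) error probability $\frac1{M_n}\sum_{i=1}^{M_n}W^n(\{\mathbf{y}:d_n(\mathbf{y})\ne i\}|e_n(i))$. A rate $R$ is achievable if there are such codes with error probability tending to $0$ and $\liminf_{n\to\infty}\frac1n\log M_n\ge R$; the capacity $C(\mathbf{W})$ is the supremum of all achievable rates. The channel $\mathbf{W}$ satisfies the strong converse property if for every $R>C(\mathbf{W})$ every sequence of channel codes with $\liminf_{n\to\infty}\frac1n\log M_n\ge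 R$ has error probability tending to $1$ as $n\to\infty$. Two-step encoding (separation of codings): there are integers $M_n$, fixed-length source codes $(f_n,g_n)$ with $M_n$ codewords whose error probability tends to $0$, and channel codes $(e_n,d_n)$ with $M_n$ messages whose maximum error probability $\max_i W^n(\{\mathbf{y}:d_n(\mathbf{y})\ne i\}|e_n(i))$ tends to $0$; the joint code is $\varphi_n=e_n\circ f_n$, $\psi_n=g_n\circ d_n$. *)

theory Defs
  imports "HOL-Probability.Probability"
begin

text \<open>
  A word of length \<open>n\<close> is an extensional function on \<open>{..<n}\<close>. Only block lengths \<open>n \<ge> 1\<close> carry
  meaning; sequences indexed by \<open>nat\<close> are unconstrained at \<open>0\<close>.
\<close>

definition words :: "'a set \<Rightarrow> nat \<Rightarrow> (nat \<Rightarrow> 'a) set" where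
  "words A n = ({..<n} \<rightarrow>\<^sub>E A)"

definition word_space :: "'a measure \<Rightarrow> nat \<Rightarrow> (nat \<Rightarrow> 'a) measure" where
  "word_space S n = PiM {..<n} (\<lambda>_. S)"

text \<open>
  A source is given by the laws of its blocks \<open>V\<^sup>n\<close>; the blocks being discrete, these laws are
  probability mass functions. No consistency between different \<open>n\<close> is imposed.
\<close>

definition general_source :: "'v set \<Rightarrow> (nat \<Rightarrow> (nat \<Rightarrow> 'v) pmf) \<Rightarrow> bool" where
  "general_source A V \<longleftrightarrow>
     countable A \<and> infinite A \<and> (\<forall>n\<ge>1. set_pmf (V n) \<subseteq> words A n)"

definition general_channel ::
  "'x measure \<Rightarrow> 'y measure \<Rightarrow> (nat \<Rightarrow> (nat \<Rightarrow> 'x) \<Rightarrow> (nat \<Rightarrow> 'y) measure) \<Rightarrow> bool" where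
  "general_channel MX MY W \<longleftrightarrow>
     (\<forall>n\<ge>1. W n \<in> word_space MX n \<rightarrow>\<^sub>M prob_algebra (word_space MY n))"

text \<open>
  Decoders acting on channel outputs are required to be measurable, i.e. the decoding regions are
  events. (Isabelle's \<open>measure\<close> is \<open>0\<close> on sets that are not measurable.)
\<close>

definition joint_code ::
  "'v set \<Rightarrow> 'x measure \<Rightarrow> 'y measure \<Rightarrow> nat \<Rightarrow>
   ((nat \<Rightarrow> 'v) \<Rightarrow> (nat \<Rightarrow> 'x)) \<Rightarrow> ((nat \<Rightarrow> 'y) \<Rightarrow> (nat \<Rightarrow> 'v)) \<Rightarrow> bool" where
  "joint_code A MX MY n \<phi> \<psi> \<longleftrightarrow>
     \<phi> \<in> words A n \<rightarrow> space (word_space MX n) \<and>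
     \<psi> \<in> word_space MY n \<rightarrow>\<^sub>M count_space (words A n)"

definition joint_error ::
  "'v set \<Rightarrow> 'y measure \<Rightarrow> (nat \<Rightarrow> 'v) pmf \<Rightarrow> ((nat \<Rightarrow> 'x) \<Rightarrow> (nat \<Rightarrow> 'y) measure) \<Rightarrow> nat \<Rightarrow>
   ((nat \<Rightarrow> 'v) \<Rightarrow> (nat \<Rightarrow> 'x)) \<Rightarrow> ((nat \<Rightarrow> 'y) \<Rightarrow> (nat \<Rightarrow> 'v)) \<Rightarrow> real" where
  "joint_error A MY P K n \<phi> \<psi> =
     (\<Sum>\<^sub>\<infinity>v\<in>words A n. pmf P v * measure (K (\<phi> v)) {y \<in> space (word_space MY n). \<psi> y \<noteq> v})"

definition transmissible ::
  "'v set \<Rightarrow> 'x measure \<Rightarrow> 'y measure \<Rightarrow> (nat \<Rightarrow> (nat \<Rightarrow> 'v) pmf) \<Rightarrow>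
   (nat \<Rightarrow> (nat \<Rightarrow> 'x) \<Rightarrow> (nat \<Rightarrow> 'y) measure) \<Rightarrow> bool" where
  "transmissible A MX MY V W \<longleftrightarrow>
     (\<exists>\<phi> \<psi>. (\<forall>n\<ge>1. joint_code A MX MY n (\<phi> n) (\<psi> n)) \<and>
       (\<lambda>n. joint_error A MY (V n) (W n) n (\<phi> n) (\<psi> n)) \<longlonglongrightarrow> 0)"

definition rate :: "(nat \<Rightarrow> nat) \<Rightarrow> nat \<Rightarrow> ereal" where
  "rate M n = ereal (ln (real (M n)) / real n)"


subsection \<open>Fixed-length source coding\<close>

definition source_code ::
  "'v set \<Rightarrow> nat \<Rightarrow> nat \<Rightarrow> ((nat \<Rightarrow> 'v) \<Rightarrow> nat) \<Rightarrow> (nat \<Rightarrow> (nat \<Rightarrow> 'v)) \<Rightarrow> bool" where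
  "source_code A n m f g \<longleftrightarrow>
     m \<ge> 1 \<and> f \<in> words A n \<rightarrow> {1..m} \<and> g \<in> {1..m} \<rightarrow> words A n"

definition source_error ::
  "(nat \<Rightarrow> 'v) pmf \<Rightarrow> ((nat \<Rightarrow> 'v) \<Rightarrow> nat) \<Rightarrow> (nat \<Rightarrow> (nat \<Rightarrow> 'v)) \<Rightarrow> real" where
  "source_error P f g = measure_pmf.prob P {v. g (f v) \<noteq> v}"

definition source_achievable :: "'v set \<Rightarrow> (nat \<Rightarrow> (nat \<Rightarrow> 'v) pmf) \<Rightarrow> real \<Rightarrow> bool" where
  "source_achievable A V R \<longleftrightarrow>
     (\<exists>M f g. (\<forall>n\<ge>1. source_code A n (M n) (f n) (g n)) \<and>
       (\<lambda>n. source_error (V n) (f n) (g n)) \<longlonglongrightarrow> 0 \<and>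
       limsup (rate M) \<le> ereal R)"

text \<open>The infimum is taken in the extended reals: it is \<open>\<infinity>\<close> when no rate is achievable.\<close>

definition source_rate :: "'v set \<Rightarrow> (nat \<Rightarrow> (nat \<Rightarrow> 'v) pmf) \<Rightarrow> ereal" where
  "source_rate A V = Inf (ereal ` {R. source_achievable A V R})"

definition source_strong_converse :: "'v set \<Rightarrow> (nat \<Rightarrow> (nat \<Rightarrow> 'v) pmf) \<Rightarrow> bool" where
  "source_strong_converse A V \<longleftrightarrow>
     (\<forall>R::real. ereal R < source_rate A V \<longrightarrow>
       (\<forall>M f g. (\<forall>n\<ge>1. source_code A n (M n) (f n) (g n)) \<and> limsup (rate M) \<le> ereal R \<longrightarrow>
         (\<lambda>n. source_error (V n) (f n) (g n)) \<longlonglongrightarrow> 1))"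


subsection \<open>Channel coding\<close>

definition channel_code ::
  "'x measure \<Rightarrow> 'y measure \<Rightarrow> nat \<Rightarrow> nat \<Rightarrow>
   (nat \<Rightarrow> (nat \<Rightarrow> 'x)) \<Rightarrow> ((nat \<Rightarrow> 'y) \<Rightarrow> nat) \<Rightarrow> bool" where
  "channel_code MX MY n m e d \<longleftrightarrow>
     m \<ge> 1 \<and> e \<in> {1..m} \<rightarrow> space (word_space MX n) \<and>
     d \<in> word_space MY n \<rightarrow>\<^sub>M count_space {1..m}"

definition message_error ::
  "'y measure \<Rightarrow> ((nat \<Rightarrow> 'x) \<Rightarrow> (nat \<Rightarrow> 'y) measure) \<Rightarrow> nat \<Rightarrow>
   (nat \<Rightarrow> (nat \<Rightarrow> 'x)) \<Rightarrow> ((nat \<Rightarrow> 'y) \<Rightarrow> nat) \<Rightarrow> nat \<Rightarrow> real" where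
  "message_error MY K n e d i = measure (K (e i)) {y \<in> space (word_space MY n). d y \<noteq> i}"

definition average_error ::
  "'y measure \<Rightarrow> ((nat \<Rightarrow> 'x) \<Rightarrow> (nat \<Rightarrow> 'y) measure) \<Rightarrow> nat \<Rightarrow> nat \<Rightarrow>
   (nat \<Rightarrow> (nat \<Rightarrow> 'x)) \<Rightarrow> ((nat \<Rightarrow> 'y) \<Rightarrow> nat) \<Rightarrow> real" where
  "average_error MY K n m e d = (\<Sum>i=1..m. message_error MY K n e d i) / real m"

definition maximum_error ::
  "'y measure \<Rightarrow> ((nat \<Rightarrow> 'x) \<Rightarrow> (nat \<Rightarrow> 'y) measure) \<Rightarrow> nat \<Rightarrow> nat \<Rightarrow>
   (nat \<Rightarrow> (nat \<Rightarrow> 'x)) \<Rightarrow> ((nat \<Rightarrow> 'y) \<Rightarrow> nat) \<Rightarrow> real" where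
  "maximum_error MY K n m e d = (MAX i\<in>{1..m}. message_error MY K n e d i)"

definition channel_achievable ::
  "'x measure \<Rightarrow> 'y measure \<Rightarrow> (nat \<Rightarrow> (nat \<Rightarrow> 'x) \<Rightarrow> (nat \<Rightarrow> 'y) measure) \<Rightarrow> real \<Rightarrow> bool" where
  "channel_achievable MX MY W R \<longleftrightarrow>
     (\<exists>M e d. (\<forall>n\<ge>1. channel_code MX MY n (M n) (e n) (d n)) \<and>
       (\<lambda>n. average_error MY (W n) n (M n) (e n) (d n)) \<longlonglongrightarrow> 0 \<and>
       liminf (rate M) \<ge> ereal R)"

definition capacity ::
  "'x measure \<Rightarrow> 'y measure \<Rightarrow> (nat \<Rightarrow> (nat \<Rightarrow> 'x) \<Rightarrow> (nat \<Rightarrow> 'y) measure) \<Rightarrow> ereal" where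
  "capacity MX MY W = Sup (ereal ` {R. channel_achievable MX MY W R})"

definition channel_strong_converse ::
  "'x measure \<Rightarrow> 'y measure \<Rightarrow> (nat \<Rightarrow> (nat \<Rightarrow> 'x) \<Rightarrow> (nat \<Rightarrow> 'y) measure) \<Rightarrow> bool" where
  "channel_strong_converse MX MY W \<longleftrightarrow>
     (\<forall>R::real. ereal R > capacity MX MY W \<longrightarrow>
       (\<forall>M e d. (\<forall>n\<ge>1. channel_code MX MY n (M n) (e n) (d n)) \<and> liminf (rate M) \<ge> ereal R \<longrightarrow>
         (\<lambda>n. average_error MY (W n) n (M n) (e n) (d n)) \<longlonglongrightarrow> 1))"


subsection \<open>Separation of source and channel coding\<close>

text \<open>
  The same \<open>M n\<close> serves as number of source codewords and number of channel messages. The last two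
  conjuncts say that the composed codes are joint codes that achieve transmissibility.
\<close>

definition two_step_transmissible ::
  "'v set \<Rightarrow> 'x measure \<Rightarrow> 'y measure \<Rightarrow> (nat \<Rightarrow> (nat \<Rightarrow> 'v) pmf) \<Rightarrow>
   (nat \<Rightarrow> (nat \<Rightarrow> 'x) \<Rightarrow> (nat \<Rightarrow> 'y) measure) \<Rightarrow> bool" where
  "two_step_transmissible A MX MY V W \<longleftrightarrow>
     (\<exists>M f g e d.
       (\<forall>n\<ge>1. source_code A n (M n) (f n) (g n)) \<and>
       (\<lambda>n. source_error (V n) (f n) (g n)) \<longlonglongrightarrow> 0 \<and>
       (\<forall>n\<ge>1. channel_code MX MY n (M n) (e n) (d n)) \<and>
       (\<lambda>n. maximum_error MY (W n) n (M n) (e n) (d n)) \<longlonglongrightarrow> 0 \<and>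
       (\<forall>n\<ge>1. joint_code A MX MY n (e n \<circ> f n) (g n \<circ> d n)) \<and>
       (\<lambda>n. joint_error A MY (V n) (W n) n (e n \<circ> f n) (g n \<circ> d n)) \<longlonglongrightarrow> 0)"

end

theory Submission
  imports Defs "HOL-Real_Asymp.Real_Asymp"
begin

text \<open>
  \<^bold>\<open>Direct part.\<close> If \<open>R\<^sub>f < C\<close>, there are achievable rates \<open>R\<^sub>1 < R\<^sub>2\<close> of the source and of the channel.
  Source codes of rate \<open>R\<^sub>1\<close> have, for large \<open>n\<close>, exponentially fewer codewords than channel codes of rate
  \<open>R\<^sub>2\<close> have messages. Discarding the worse half of the messages turns a small average error into a small
  maximum error (\<open>expurgation\<close>) and still leaves enough messages to carry the source codewords. The
  error of the concatenation is at most the sum of the two errors (\<open>joint_error_concatenation\<close>).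

  \<^bold>\<open>Converse part.\<close> Suppose that \<open>C < R < R\<^sub>f\<close> and that the source is transmissible. Everything is
  decided by the probability \<open>p\<^sub>n\<close> of the event \<open>P(V\<^sup>n) \<le> exp (- n R)\<close> of improbable words.

  On the one hand, at most \<open>exp (n R)\<close> words are not improbable, so that there are source codes of rate
  \<open>R\<close> whose error is at most \<open>p\<^sub>n\<close> (\<open>source_codes_for_probable_words\<close>).

  On the other hand, if \<open>p\<^sub>n \<ge> \<delta>\<close> while the joint code decodes well on average, then the improbable
  words that are decoded well have total probability at least \<open>\<delta>/2\<close>, by the Markov inequality; since
  each of them has probability at most \<open>exp (- n R)\<close>, there are at least \<open>(\<delta>/2) exp (n R)\<close> of them. Using
  them as messages makes the joint code a channel code of rate \<open>R\<close> with small error, so no random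
  coding is needed (\<open>channel_codes_from_transmissibility\<close>).

  If the source has the strong converse property, then \<open>p\<^sub>n \<longlonglongrightarrow> 1\<close> because \<open>R < R\<^sub>f\<close>, and the channel
  codes show that \<open>R\<close> is achievable, against \<open>C < R\<close>. If the channel has it, then all channel codes of
  rate \<open>R > C\<close> are bad for large \<open>n\<close>, so that \<open>p\<^sub>n < \<delta>\<close> eventually, for every \<open>\<delta> > 0\<close>; hence
  \<open>p\<^sub>n \<longlonglongrightarrow> 0\<close>, and the source codes show that \<open>R\<close> is achievable, against \<open>R < R\<^sub>f\<close>.
\<close>


section \<open>Rates\<close>

lemma limsup_rate_le:
  assumes c: "c > 0" and ev: "\<forall>\<^sub>F n in sequentially. 1 \<le> M n \<and> real (M n) \<le> c * exp (real n * R)"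
  shows "limsup (rate M) \<le> ereal R"
proof -
  have lim: "(\<lambda>n. ereal (R + ln c / real n)) \<longlonglongrightarrow> ereal R"
    by (rule tendsto_ereal) real_asymp
  have "limsup (rate M) \<le> limsup (\<lambda>n. ereal (R + ln c / real n))"
  proof (rule Limsup_mono)
    show "\<forall>\<^sub>F n in sequentially. rate M n \<le> ereal (R + ln c / real n)"
      using ev eventually_ge_at_top[of 1]
    proof eventually_elim
      case (elim n)
      then have "ln (real (M n)) \<le> ln (c * exp (real n * R))"
        using c by (intro ln_mono) auto
      also have "\<dots> = ln c + real n * R"
        using c by (simp add: ln_mult)
      finally have "ln (real (M n)) / real n \<le> (ln c + real n * R) / real n"
        by (intro divide_right_mono) auto
      then show ?case
        using elim by (simp add: rate_def add_divide_distrib add.commute)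
    qed
  qed
  also have "\<dots> = ereal R"
    using lim by (intro lim_imp_Limsup) auto
  finally show ?thesis .
qed

lemma liminf_rate_ge:
  assumes c: "c > 0" and ev: "\<forall>\<^sub>F n in sequentially. c * exp (real n * R) \<le> real (M n)"
  shows "ereal R \<le> liminf (rate M)"
proof -
  have lim: "(\<lambda>n. ereal (R + ln c / real n)) \<longlonglongrightarrow> ereal R"
    by (rule tendsto_ereal) real_asymp
  have "ereal R = liminf (\<lambda>n. ereal (R + ln c / real n))"
    using lim by (intro lim_imp_Liminf[symmetric]) auto
  also have "\<dots> \<le> liminf (rate M)"
  proof (rule Liminf_mono)
    show "\<forall>\<^sub>F n in sequentially. ereal (R + ln c / real n) \<le> rate M n"
      using ev eventually_ge_at_top[of 1]
    proof eventually_elim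
      case (elim n)
      have "ln c + real n * R = ln (c * exp (real n * R))"
        using c by (simp add: ln_mult)
      also have "\<dots> \<le> ln (real (M n))"
        using c elim by (intro ln_mono) auto
      finally have "(ln c + real n * R) / real n \<le> ln (real (M n)) / real n"
        by (intro divide_right_mono) auto
      then show ?case
        using elim by (simp add: rate_def add_divide_distrib add.commute)
    qed
  qed
  finally show ?thesis .
qed

lemma eventually_double_le_of_rates:
  assumes sup: "limsup (rate M) \<le> ereal r" and inf: "ereal s \<le> liminf (rate L)" and "r < s"
    and M: "\<forall>\<^sub>F n in sequentially. 1 \<le> M n" and L: "\<forall>\<^sub>F n in sequentially. 1 \<le> L n"
  shows "\<forall>\<^sub>F n in sequentially. 2 * M n \<le> L n"
proof -
  define u v where "u = r + (s - r) / 3" and "v = s - (s - r) / 3"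
  have uv: "r < u" "u < v" "v < s"
    using \<open>r < s\<close> by (auto simp: u_def v_def field_simps)
  have "\<forall>\<^sub>F n in sequentially. rate M n < ereal u"
    using sup uv by (intro Limsup_lessD) (auto elim: le_less_trans)
  moreover have "\<forall>\<^sub>F n in sequentially. ereal v < rate L n"
    using inf uv by (intro less_LiminfD) (auto elim: less_le_trans[rotated])
  moreover have "\<forall>\<^sub>F n in sequentially. ln 2 \<le> real n * (v - u)"
    using uv by real_asymp
  ultimately show ?thesis
    using M L eventually_ge_at_top[of 1]
  proof eventually_elim
    case (elim n)
    have "ln (2 * real (M n)) = ln 2 + ln (real (M n))"
      using elim by (simp add: ln_mult)
    also have "\<dots> \<le> real n * (v - u) + real n * u"
      using elim by (intro add_mono) (auto simp: rate_def field_simps)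
    also have "\<dots> = real n * v"
      by (simp add: algebra_simps)
    also have "\<dots> \<le> ln (real (L n))"
      using elim by (auto simp: rate_def field_simps)
    finally have "2 * real (M n) \<le> real (L n)"
      using elim by (subst (asm) ln_le_cancel_iff) auto
    then show ?case
      by linarith
  qed
qed


section \<open>Finite sets of words\<close>

lemma card_pmf_gt_le:
  assumes "t > 0"
  shows "finite {v. pmf P v > t}" "real (card {v. pmf P v > t}) \<le> 1 / t"
proof -
  have *: "real (card F) \<le> 1 / t" if F: "F \<subseteq> {v. pmf P v > t}" "finite F" for F
  proof -
    have "real (card F) * t = (\<Sum>v\<in>F. t)"
      by simp
    also have "\<dots> \<le> (\<Sum>v\<in>F. pmf P v)"
      using F by (intro sum_mono) auto
    also have "\<dots> = measure_pmf.prob P F"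
      using F by (simp add: measure_measure_pmf_finite)
    also have "\<dots> \<le> 1"
      by simp
    finally show ?thesis
      using assms by (simp add: field_simps)
  qed
  have "finite {v. pmf P v > t} \<and> card {v. pmf P v > t} \<le> nat \<lfloor>1 / t\<rfloor>"
    using * by (intro finite_if_finite_subsets_card_bdd) (auto simp: le_nat_floor)
  then show fin: "finite {v. pmf P v > t}"
    by blast
  show "real (card {v. pmf P v > t}) \<le> 1 / t"
    using * fin by blast
qed

text \<open>Stated so that infinite sets, whose cardinality is \<open>0\<close> by convention, are covered as well.\<close>

lemma obtain_enumerated_subset:
  assumes "finite G \<Longrightarrow> m \<le> card G"
  obtains h where "inj_on h {1..m::nat}" "h ` {1..m} \<subseteq> G"
proof -
  obtain T where T: "T \<subseteq> G" "finite T" "card T = m"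
  proof (cases "finite G")
    case True
    then show ?thesis
      using assms that by (metis obtain_subset_with_card_n)
  next
    case False
    then show ?thesis
      using that infinite_arbitrarily_large by metis
  qed
  then obtain h where "bij_betw h {1..m} T"
    using ex_bij_betw_nat_finite_1 by metis
  then show ?thesis
    using that[of h] T by (auto simp: bij_betw_def)
qed

lemma source_code_for_finite_set:
  assumes S: "S \<subseteq> words A n" "finite S" "card S \<le> m" and m: "1 \<le> m" and w: "w \<in> words A n"
  obtains f g where "source_code A n m f g" "\<And>v. v \<in> S \<Longrightarrow> g (f v) = v"
proof -
  obtain h where h: "inj_on h S" "h ` S \<subseteq> {1..m}"
    using S inj_on_iff_card_le[of S "{1..m}"] by auto
  define f where "f v = (if v \<in> S then h v else 1)" for v
  define g where "g i = (if i \<in> h ` S then inv_into S h i else w)" for i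
  have "f v \<in> {1..m}" for v
    using h(2) m by (auto simp: f_def image_subset_iff)
  moreover have "g i \<in> words A n" for i
    using inv_into_into[of i h S] S(1) w by (auto simp: g_def)
  ultimately have "source_code A n m f g"
    using m by (simp add: source_code_def)
  moreover have "g (f v) = v" if "v \<in> S" for v
    using that h by (simp add: f_def g_def)
  ultimately show ?thesis
    using that by blast
qed


section \<open>Source codes for the probable words\<close>

lemma source_codes_for_probable_words:
  assumes src: "general_source A V" and R: "0 \<le> R"
  shows "\<exists>M f g. (\<forall>n\<ge>1. source_code A n (M n) (f n) (g n)) \<and> limsup (rate M) \<le> ereal R \<and>
           (\<forall>n\<ge>1. source_error (V n) (f n) (g n)
                     \<le> measure_pmf.prob (V n) {v. pmf (V n) v \<le> exp (- (real n * R))})"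
proof -
  define M where "M n = nat \<lceil>exp (real n * R)\<rceil>" for n
  have "\<exists>f g. n \<ge> 1 \<longrightarrow> source_code A n (M n) f g \<and>
          source_error (V n) f g
            \<le> measure_pmf.prob (V n) {v. pmf (V n) v \<le> exp (- (real n * R))}" for n
  proof (cases "n \<ge> 1")
    case True
    let ?S = "{v. pmf (V n) v > exp (- (real n * R))}"
    have V: "set_pmf (V n) \<subseteq> words A n"
      using src True by (simp add: general_source_def)
    then obtain w where w: "w \<in> words A n"
      using set_pmf_not_empty[of "V n"] by blast
    have S: "?S \<subseteq> words A n"
    proof
      fix v
      assume "v \<in> ?S"
      then have "0 < pmf (V n) v"
        using exp_gt_zero less_trans by blast
      then show "v \<in> words A n"
        using V by (auto simp: pmf_positive_iff)
    qed
    have "real (card ?S) \<le> 1 / exp (- (real n * R))"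
      by (rule card_pmf_gt_le) simp
    then have "card ?S \<le> M n"
      unfolding M_def by (simp add: exp_minus field_simps) linarith
    moreover have "finite ?S"
      by (rule card_pmf_gt_le) simp
    moreover have "1 \<le> M n"
      by (simp add: M_def Suc_le_eq)
    ultimately obtain f g where fg: "source_code A n (M n) f g" "\<And>v. v \<in> ?S \<Longrightarrow> g (f v) = v"
      using source_code_for_finite_set[OF S] w by metis
    have "source_error (V n) f g
            \<le> measure_pmf.prob (V n) {v. pmf (V n) v \<le> exp (- (real n * R))}"
      unfolding source_error_def
      by (rule measure_pmf.finite_measure_mono) (use fg(2) in \<open>auto simp: not_le[symmetric]\<close>)
    with fg(1) show ?thesis
      by blast
  qed auto
  then obtain f g where fg:
    "\<And>n. n \<ge> 1 \<Longrightarrow> source_code A n (M n) (f n) (g n) \<and>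
       source_error (V n) (f n) (g n)
         \<le> measure_pmf.prob (V n) {v. pmf (V n) v \<le> exp (- (real n * R))}"
    by metis
  have "limsup (rate M) \<le> ereal R"
  proof (rule limsup_rate_le[of 2])
    \<comment> \<open>\<open>R \<ge> 0\<close> makes \<open>exp (n R)\<close> at least \<open>1\<close>, so that rounding up at most doubles it\<close>
    have "1 \<le> M n \<and> real (M n) \<le> 2 * exp (real n * R)" for n
    proof -
      have "1 \<le> exp (real n * R)"
        using R by simp
      then show ?thesis
        unfolding M_def by linarith
    qed
    then show "\<forall>\<^sub>F n in sequentially. 1 \<le> M n \<and> real (M n) \<le> 2 * exp (real n * R)"
      by simp
  qed simp
  with fg show ?thesis
    by blast
qed


section \<open>Channel codes with selected messages\<close>

text \<open>
  The type of the messages is arbitrary, so that the numbers sent by a channel code and the source words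
  sent by a joint code can be treated alike.
\<close>

definition decoding_error ::
  "'y measure \<Rightarrow> ((nat \<Rightarrow> 'x) \<Rightarrow> (nat \<Rightarrow> 'y) measure) \<Rightarrow> nat \<Rightarrow>
   ('c \<Rightarrow> (nat \<Rightarrow> 'x)) \<Rightarrow> ((nat \<Rightarrow> 'y) \<Rightarrow> 'c) \<Rightarrow> 'c \<Rightarrow> real" where
  "decoding_error MY K n \<phi> \<psi> v = measure (K (\<phi> v)) {y \<in> space (word_space MY n). \<psi> y \<noteq> v}"

lemma message_error_eq_decoding_error: "message_error MY K n e d i = decoding_error MY K n e d i"
  by (simp add: message_error_def decoding_error_def)

lemma error_event_in_sets:
  assumes "\<psi> \<in> N \<rightarrow>\<^sub>M count_space D"
  shows "{y \<in> space N. \<psi> y \<noteq> v} \<in> sets N"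
proof -
  have "\<psi> -` (D - {v}) \<inter> space N \<in> sets N"
    using assms by (rule measurable_sets) auto
  moreover have "\<psi> -` (D - {v}) \<inter> space N = {y \<in> space N. \<psi> y \<noteq> v}"
    using measurable_space[OF assms] by auto
  ultimately show ?thesis
    by simp
qed

lemma kernel_at:
  assumes "K \<in> N \<rightarrow>\<^sub>M prob_algebra N'" "x \<in> space N"
  shows "prob_space (K x)" "sets (K x) = sets N'"
  using measurable_space[OF assms] by (auto simp: space_prob_algebra)

lemma measure_kernel_mono:
  assumes "K \<in> N \<rightarrow>\<^sub>M prob_algebra N'" "x \<in> space N" "B \<subseteq> C" "C \<in> sets N'"
  shows "measure (K x) B \<le> measure (K x) C"
proof -
  interpret prob_space "K x"
    by (rule kernel_at[OF assms(1,2)])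
  show ?thesis
    using assms kernel_at[OF assms(1,2)] by (intro finite_measure_mono) auto
qed

lemma decoding_error_bounds:
  assumes "K \<in> word_space MX n \<rightarrow>\<^sub>M prob_algebra (word_space MY n)" "\<phi> v \<in> space (word_space MX n)"
  shows "0 \<le> decoding_error MY K n \<phi> \<psi> v" "decoding_error MY K n \<phi> \<psi> v \<le> 1"
proof -
  interpret prob_space "K (\<phi> v)"
    by (rule kernel_at[OF assms])
  show "0 \<le> decoding_error MY K n \<phi> \<psi> v" "decoding_error MY K n \<phi> \<psi> v \<le> 1"
    unfolding decoding_error_def by auto
qed

text \<open>
  Both expurgation and the passage from a joint code to a channel code keep a subset \<open>G\<close> of the messages
  of a given code: enumerate \<open>m\<close> elements of \<open>G\<close>, and redirect every other decision of the decoder to an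
  arbitrary message, which can only reduce the error events.
\<close>

lemma channel_code_of_selected_messages:
  assumes K: "K \<in> word_space MX n \<rightarrow>\<^sub>M prob_algebra (word_space MY n)"
    and \<psi>: "\<psi> \<in> word_space MY n \<rightarrow>\<^sub>M count_space D"
    and \<phi>: "\<And>v. v \<in> G \<Longrightarrow> \<phi> v \<in> space (word_space MX n)"
    and m: "1 \<le> m" "finite G \<Longrightarrow> m \<le> card G"
    and err: "\<And>v. v \<in> G \<Longrightarrow> decoding_error MY K n \<phi> \<psi> v \<le> a"
  obtains e d where "channel_code MX MY n m e d" "\<And>i. i \<in> {1..m} \<Longrightarrow> message_error MY K n e d i \<le> a"
proof -
  obtain h where h: "inj_on h {1..m}" "h ` {1..m} \<subseteq> G"
    using m(2) by (rule obtain_enumerated_subset)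
  define r where "r z = (if z \<in> h ` {1..m} then inv_into {1..m} h z else 1)" for z
  have r: "r z \<in> {1..m}" for z
    using m(1) inv_into_into[of z h "{1..m}"] by (auto simp: r_def)
  have rh: "r (h i) = i" if "i \<in> {1..m}" for i
    using that h by (simp add: r_def)
  have "r \<circ> \<psi> \<in> word_space MY n \<rightarrow>\<^sub>M count_space {1..m}"
    using \<psi> by (rule measurable_comp) (use r in simp)
  then have "channel_code MX MY n m (\<phi> \<circ> h) (r \<circ> \<psi>)"
    using m(1) \<phi> h by (auto simp: channel_code_def)
  moreover have "message_error MY K n (\<phi> \<circ> h) (r \<circ> \<psi>) i \<le> a" if i: "i \<in> {1..m}" for i
  proof -
    have hi: "h i \<in> G"
      using h i by blast
    have "message_error MY K n (\<phi> \<circ> h) (r \<circ> \<psi>) i \<le> decoding_error MY K n \<phi> \<psi> (h i)"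
      unfolding message_error_def decoding_error_def o_apply
      by (rule measure_kernel_mono[OF K \<phi>[OF hi] _ error_event_in_sets[OF \<psi>]])
        (use rh[OF i] in auto)
    also have "\<dots> \<le> a"
      by (rule err[OF hi])
    finally show ?thesis .
  qed
  ultimately show ?thesis
    using that by blast
qed

lemma average_error_le:
  assumes "1 \<le> m" "\<And>i. i \<in> {1..m} \<Longrightarrow> message_error MY K n e d i \<le> a"
  shows "average_error MY K n m e d \<le> a"
proof -
  have "(\<Sum>i=1..m. message_error MY K n e d i) \<le> real (card {1..m}) * a"
    using assms by (intro sum_bounded_above) auto
  then show ?thesis
    using assms(1) by (simp add: average_error_def field_simps)
qed

lemma average_error_nonneg: "0 \<le> average_error MY K n m e d"
  unfolding average_error_def message_error_def by (intro divide_nonneg_nonneg sum_nonneg) auto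

text \<open>Fewer than half of the messages can have more than twice the average error.\<close>

lemma expurgation:
  assumes K: "K \<in> word_space MX n \<rightarrow>\<^sub>M prob_algebra (word_space MY n)"
    and code: "channel_code MX MY n m e d" and k: "1 \<le> k" "2 * k \<le> m"
  obtains e' d' where "channel_code MX MY n k e' d'"
    "\<And>i. i \<in> {1..k} \<Longrightarrow> message_error MY K n e' d' i \<le> 2 * average_error MY K n m e d"
proof -
  define a where "a = average_error MY K n m e d"
  define G where "G = {i \<in> {1..m}. message_error MY K n e d i \<le> 2 * a}"
  define B where "B = {i \<in> {1..m}. 2 * a < message_error MY K n e d i}"
  have a: "0 \<le> a"
    unfolding a_def by (rule average_error_nonneg)
  have "2 * card B \<le> m"
  proof (rule ccontr)
    assume large: "\<not> 2 * card B \<le> m"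
    then have "B \<noteq> {}"
      by auto
    have "real m * a \<le> (2 * real (card B)) * a"
      using large a by (intro mult_right_mono) auto
    also have "\<dots> = (\<Sum>i\<in>B. 2 * a)"
      by simp
    also have "\<dots> < (\<Sum>i\<in>B. message_error MY K n e d i)"
      using \<open>B \<noteq> {}\<close> by (intro sum_strict_mono) (auto simp: B_def)
    also have "\<dots> \<le> (\<Sum>i=1..m. message_error MY K n e d i)"
      by (intro sum_mono2) (auto simp: B_def message_error_def)
    also have "\<dots> = real m * a"
      using k by (simp add: a_def average_error_def)
    finally show False
      by simp
  qed
  moreover have "card G + card B = m"
  proof -
    have "card (G \<union> B) = card G + card B"
      by (rule card_Un_disjoint) (auto simp: G_def B_def)
    moreover have "G \<union> B = {1..m}"
      by (auto simp: G_def B_def)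
    ultimately show ?thesis
      by simp
  qed
  ultimately have "k \<le> card G"
    using k by linarith
  moreover have "d \<in> word_space MY n \<rightarrow>\<^sub>M count_space {1..m}"
    using code by (simp add: channel_code_def)
  moreover have "e i \<in> space (word_space MX n)" if "i \<in> G" for i
    using code that by (auto simp: channel_code_def G_def)
  moreover have "decoding_error MY K n e d i \<le> 2 * a" if "i \<in> G" for i
    using that by (simp add: G_def message_error_eq_decoding_error)
  ultimately show ?thesis
    using channel_code_of_selected_messages[OF K, of d "{1..m}" G e k "2 * a"] k(1) that
    unfolding a_def by metis
qed

lemma constant_channel_code:
  assumes "x \<in> space (word_space MX n)" "1 \<le> m"
  shows "channel_code MX MY n m (\<lambda>_. x) (\<lambda>_. 1)"
  using assms by (auto simp: channel_code_def)


section \<open>Joint codes\<close>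

lemma joint_error_eq_expectation:
  assumes "set_pmf P \<subseteq> words A n"
    and bounds: "\<And>v. v \<in> words A n \<Longrightarrow> 0 \<le> decoding_error MY K n \<phi> \<psi> v \<and> decoding_error MY K n \<phi> \<psi> v \<le> 1"
  shows "joint_error A MY P K n \<phi> \<psi> = measure_pmf.expectation P (decoding_error MY K n \<phi> \<psi>)"
proof -
  let ?q = "\<lambda>v. pmf P v * decoding_error MY K n \<phi> \<psi> v"
  have out: "?q v = 0" if "v \<notin> words A n" for v
    using that assms by (auto simp: pmf_eq_0_set_pmf)
  have "norm (?q v) \<le> pmf P v" for v
  proof (cases "v \<in> words A n")
    case True
    then show ?thesis
      using bounds[OF True] by (simp add: mult_left_le)
  next
    case False
    then have "?q v = 0"
      by (rule out)
    then show ?thesis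
      by (simp only: norm_zero pmf_nonneg)
  qed
  then have "Infinite_Set_Sum.abs_summable_on ?q UNIV"
    by (intro abs_summable_on_comparison_test[OF pmf_abs_summable[of P UNIV]]) simp
  then have "infsetsum ?q UNIV = infsum ?q UNIV"
    by (rule infsetsum_infsum)
  also have "\<dots> = infsum ?q (words A n)"
    by (rule infsum_cong_neutral) (use out in auto)
  finally show ?thesis
    by (simp add: joint_error_def pmf_expectation_eq_infsetsum decoding_error_def)
qed

lemma integrable_decoding_error:
  assumes "set_pmf P \<subseteq> words A n"
    and "\<And>v. v \<in> words A n \<Longrightarrow> 0 \<le> decoding_error MY K n \<phi> \<psi> v \<and> decoding_error MY K n \<phi> \<psi> v \<le> 1"
  shows "integrable (measure_pmf P) (decoding_error MY K n \<phi> \<psi>)"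
  by (rule measure_pmf.integrable_const_bound[where B = 1])
    (use assms in \<open>auto simp: AE_measure_pmf_iff\<close>)

lemma joint_code_decoding_error:
  assumes "K \<in> word_space MX n \<rightarrow>\<^sub>M prob_algebra (word_space MY n)" "joint_code A MX MY n \<phi> \<psi>"
    and "v \<in> words A n"
  shows "0 \<le> decoding_error MY K n \<phi> \<psi> v \<and> decoding_error MY K n \<phi> \<psi> v \<le> 1"
proof -
  have "\<phi> v \<in> space (word_space MX n)"
    using assms by (auto simp: joint_code_def)
  then show ?thesis
    using decoding_error_bounds[where \<phi> = \<phi>, OF assms(1)] by blast
qed

lemma joint_code_concatenation:
  assumes "source_code A n m f g" "channel_code MX MY n m e d"
  shows "joint_code A MX MY n (e \<circ> f) (g \<circ> d)"
proof -
  have "g \<in> count_space {1..m} \<rightarrow>\<^sub>M count_space (words A n)"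
    using assms by (auto simp: source_code_def)
  then have "g \<circ> d \<in> word_space MY n \<rightarrow>\<^sub>M count_space (words A n)"
    using assms by (intro measurable_comp[of d]) (auto simp: channel_code_def)
  then show ?thesis
    using assms by (auto simp: joint_code_def source_code_def channel_code_def)
qed

text \<open>A word that the source code recovers is lost only if the channel decoder misses its codeword.\<close>

lemma joint_error_concatenation:
  assumes K: "K \<in> word_space MX n \<rightarrow>\<^sub>M prob_algebra (word_space MY n)"
    and P: "set_pmf P \<subseteq> words A n"
    and sc: "source_code A n m f g" and cc: "channel_code MX MY n m e d"
    and err: "\<And>i. i \<in> {1..m} \<Longrightarrow> message_error MY K n e d i \<le> a"
  shows "joint_error A MY P K n (e \<circ> f) (g \<circ> d) \<le> source_error P f g + a"
proof -
  have jc: "joint_code A MX MY n (e \<circ> f) (g \<circ> d)"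
    using sc cc by (rule joint_code_concatenation)
  note bounds = joint_code_decoding_error[OF K jc]
  have d: "d \<in> word_space MY n \<rightarrow>\<^sub>M count_space {1..m}"
    using cc by (simp add: channel_code_def)
  have "0 \<le> message_error MY K n e d 1"
    by (simp add: message_error_def)
  also have "\<dots> \<le> a"
    using sc by (intro err) (auto simp: source_code_def)
  finally have a: "0 \<le> a" .
  let ?S = "{v. g (f v) \<noteq> v}"
  have pointwise: "decoding_error MY K n (e \<circ> f) (g \<circ> d) v \<le> indicator ?S v + a"
    if v: "v \<in> words A n" for v
  proof (cases "v \<in> ?S")
    case True
    then show ?thesis
      using bounds[OF v] a by simp
  next
    case False
    have fv: "f v \<in> {1..m}"
      using sc v by (auto simp: source_code_def)
    then have "e (f v) \<in> space (word_space MX n)"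
      using cc by (auto simp: channel_code_def)
    then have "decoding_error MY K n (e \<circ> f) (g \<circ> d) v \<le> message_error MY K n e d (f v)"
      unfolding decoding_error_def message_error_def o_apply
      by (rule measure_kernel_mono[OF K _ _ error_event_in_sets[OF d]]) (use False in auto)
    also have "\<dots> \<le> a"
      by (rule err[OF fv])
    finally show ?thesis
      using False by simp
  qed
  have "joint_error A MY P K n (e \<circ> f) (g \<circ> d)
          = measure_pmf.expectation P (decoding_error MY K n (e \<circ> f) (g \<circ> d))"
    using joint_error_eq_expectation[OF P bounds] .
  also have "\<dots> \<le> measure_pmf.expectation P (\<lambda>v. indicator ?S v + a)"
  proof (rule integral_mono_AE)
    show "integrable (measure_pmf P) (decoding_error MY K n (e \<circ> f) (g \<circ> d))"
      using P bounds by (rule integrable_decoding_error)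
    show "integrable (measure_pmf P) (\<lambda>v. indicator ?S v + a)"
      by (intro Bochner_Integration.integrable_add measure_pmf.integrable_const)
        (auto intro!: measure_pmf.integrable_const_bound[where B = 1])
    show "AE v in measure_pmf P. decoding_error MY K n (e \<circ> f) (g \<circ> d) v \<le> indicator ?S v + a"
      using P pointwise by (auto simp: AE_measure_pmf_iff)
  qed
  also have "\<dots> = source_error P f g + a"
    by (subst Bochner_Integration.integral_add)
      (auto intro!: measure_pmf.integrable_const_bound[where B = 1] simp: source_error_def)
  finally show ?thesis .
qed

text \<open>
  By the Markov inequality and the last hypothesis, the words of probability at most \<open>t\<close> on which the
  joint code errs with probability less than \<open>a\<close> have total probability more than \<open>(m - 1) t\<close>. Hence
  there are at least \<open>m\<close> of them, and they can serve as messages.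
\<close>

lemma channel_code_from_joint_code:
  assumes K: "K \<in> word_space MX n \<rightarrow>\<^sub>M prob_algebra (word_space MY n)"
    and P: "set_pmf P \<subseteq> words A n"
    and jc: "joint_code A MX MY n \<phi> \<psi>"
    and t: "0 < t" and a: "0 < a" and m: "1 \<le> m"
    and large: "(real m - 1) * t
                  < measure_pmf.prob P {v. pmf P v \<le> t} - joint_error A MY P K n \<phi> \<psi> / a"
  obtains e d where "channel_code MX MY n m e d" "\<And>i. i \<in> {1..m} \<Longrightarrow> message_error MY K n e d i \<le> a"
proof -
  let ?q = "decoding_error MY K n \<phi> \<psi>"
  note bounds = joint_code_decoding_error[OF K jc]
  define G where "G = {v \<in> words A n. pmf P v \<le> t \<and> ?q v < a}"
  have markov: "measure_pmf.prob P {v. a \<le> ?q v} \<le> joint_error A MY P K n \<phi> \<psi> / a"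
  proof -
    have "AE v in measure_pmf P. 0 \<le> ?q v"
      using P bounds by (auto simp: AE_measure_pmf_iff)
    then have "measure_pmf.prob P {v \<in> space (measure_pmf P). a \<le> ?q v}
                 \<le> measure_pmf.expectation P ?q / a"
      using integrable_decoding_error[OF P bounds] a
      by (intro integral_Markov_inequality_measure[where A = "{}"]) auto
    then show ?thesis
      using joint_error_eq_expectation[OF P bounds] by simp
  qed
  have "measure_pmf.prob P {v. pmf P v \<le> t} = measure_pmf.prob P ({v. pmf P v \<le> t} \<inter> set_pmf P)"
    by (simp add: measure_Int_set_pmf)
  also have "\<dots> \<le> measure_pmf.prob P (G \<union> {v. a \<le> ?q v})"
    by (rule measure_pmf.finite_measure_mono) (use P in \<open>auto simp: G_def\<close>)
  also have "\<dots> \<le> measure_pmf.prob P G + measure_pmf.prob P {v. a \<le> ?q v}"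
    by (rule measure_Un_le) auto
  finally have G: "(real m - 1) * t < measure_pmf.prob P G"
    using large markov by linarith
  have "m \<le> card G" if "finite G"
  proof -
    have "measure_pmf.prob P G = (\<Sum>v\<in>G. pmf P v)"
      using that by (rule measure_measure_pmf_finite)
    also have "\<dots> \<le> real (card G) * t"
      by (rule sum_bounded_above) (simp add: G_def)
    finally have "(real m - 1) * t < real (card G) * t"
      using G by linarith
    then show ?thesis
      using t by simp
  qed
  moreover have "\<psi> \<in> word_space MY n \<rightarrow>\<^sub>M count_space (words A n)"
    using jc by (simp add: joint_code_def)
  moreover have "\<phi> v \<in> space (word_space MX n)" if "v \<in> G" for v
    using that jc by (auto simp: joint_code_def G_def)
  moreover have "?q v \<le> a" if "v \<in> G" for v
    using that by (simp add: G_def)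
  ultimately show ?thesis
    using channel_code_of_selected_messages[OF K, of \<psi> "words A n" G \<phi> m a] m that by metis
qed


section \<open>Transmissible sources\<close>

text \<open>
  The inequality \<open>average_error \<le> \<eta>\<close> is demanded only at those \<open>n\<close> where improbable words carry
  probability at least \<open>\<delta>\<close>; at the others a constant code with as many messages keeps the rate. If
  the source has the strong converse property, all large \<open>n\<close> are of the first kind; if the channel has
  it, the inequality shows that only finitely many are.
\<close>

lemma channel_codes_from_transmissibility:
  assumes src: "general_source A V" and ch: "general_channel MX MY W"
    and tr: "transmissible A MX MY V W" and \<delta>: "0 < \<delta>"
  shows "\<exists>M e d \<eta>. (\<forall>n\<ge>1. channel_code MX MY n (M n) (e n) (d n)) \<and> ereal R \<le> liminf (rate M) \<and>
           \<eta> \<longlonglongrightarrow> 0 \<and>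
           (\<forall>\<^sub>F n in sequentially.
              \<delta> \<le> measure_pmf.prob (V n) {v. pmf (V n) v \<le> exp (- (real n * R))} \<longrightarrow>
              average_error MY (W n) n (M n) (e n) (d n) \<le> \<eta> n)"
proof -
  obtain \<phi> \<psi> where jc: "\<And>n. n \<ge> 1 \<Longrightarrow> joint_code A MX MY n (\<phi> n) (\<psi> n)"
    and lim: "(\<lambda>n. joint_error A MY (V n) (W n) n (\<phi> n) (\<psi> n)) \<longlonglongrightarrow> 0"
    using tr unfolding transmissible_def by blast
  define \<epsilon> where "\<epsilon> n = joint_error A MY (V n) (W n) n (\<phi> n) (\<psi> n)" for n
  define p where "p n = measure_pmf.prob (V n) {v. pmf (V n) v \<le> exp (- (real n * R))}" for n
  \<comment> \<open>The threshold \<open>\<eta>\<close> exceeds \<open>\<surd>\<epsilon>\<close>, so that \<open>\<epsilon> / \<eta>\<close> is also small; the summand \<open>1 / n\<close> keeps it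
    positive even if the joint code never errs.\<close>
  define \<eta> where "\<eta> n = sqrt (\<epsilon> n + 1 / real n)" for n
  define M where "M n = nat \<lceil>\<delta> / 2 * exp (real n * R)\<rceil>" for n
  have P: "set_pmf (V n) \<subseteq> words A n" and K: "W n \<in> word_space MX n \<rightarrow>\<^sub>M prob_algebra (word_space MY n)"
    if "n \<ge> 1" for n
    using that src ch by (auto simp: general_source_def general_channel_def)
  have \<epsilon>_nonneg: "0 \<le> \<epsilon> n" for n
    unfolding \<epsilon>_def joint_error_def by (intro infsum_nonneg mult_nonneg_nonneg) auto
  have M: "1 \<le> M n" "\<delta> / 2 * exp (real n * R) \<le> real (M n)" "real (M n) - 1 < \<delta> / 2 * exp (real n * R)"
    for n
  proof -
    have "0 < \<delta> / 2 * exp (real n * R)"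
      using \<delta> by simp
    then show "1 \<le> M n" "\<delta> / 2 * exp (real n * R) \<le> real (M n)"
        "real (M n) - 1 < \<delta> / 2 * exp (real n * R)"
      unfolding M_def by linarith+
  qed
  have "(\<lambda>n. \<epsilon> n + 1 / real n) \<longlonglongrightarrow> 0 + 0"
    using lim unfolding \<epsilon>_def by (intro tendsto_add lim_1_over_n) auto
  then have \<eta>_lim: "\<eta> \<longlonglongrightarrow> 0"
    unfolding \<eta>_def using tendsto_real_sqrt by fastforce
  have "\<exists>e d. n \<ge> 1 \<longrightarrow> channel_code MX MY n (M n) e d \<and>
          (\<eta> n < \<delta> / 2 \<and> \<delta> \<le> p n \<longrightarrow> average_error MY (W n) n (M n) e d \<le> \<eta> n)" for n
  proof (cases "n \<ge> 1")
    case n: True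
    show ?thesis
    proof (cases "\<eta> n < \<delta> / 2 \<and> \<delta> \<le> p n")
      case True
      have \<eta>: "0 < \<eta> n"
        unfolding \<eta>_def using n \<epsilon>_nonneg[of n] by (auto intro: add_nonneg_pos)
      have "\<epsilon> n \<le> \<eta> n * \<eta> n"
        unfolding \<eta>_def using \<epsilon>_nonneg[of n] by simp
      then have "\<epsilon> n / \<eta> n \<le> \<eta> n"
        using \<eta> by (simp add: field_simps)
      moreover have "(real (M n) - 1) * exp (- (real n * R)) < \<delta> / 2"
        using M(3)[of n] by (simp add: exp_minus field_simps)
      ultimately have large: "(real (M n) - 1) * exp (- (real n * R)) < p n - \<epsilon> n / \<eta> n"
        using True by linarith
      obtain e d where "channel_code MX MY n (M n) e d"
        "\<And>i. i \<in> {1..M n} \<Longrightarrow> message_error MY (W n) n e d i \<le> \<eta> n"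
        using channel_code_from_joint_code[OF K[OF n] P[OF n] jc[OF n], where a = "\<eta> n" and m = "M n"
            and t = "exp (- (real n * R))"] large \<eta> M(1)
        unfolding p_def \<epsilon>_def by (metis exp_gt_zero)
      then show ?thesis
        using average_error_le M(1) by metis
    next
      case False
      obtain v where "v \<in> words A n"
        using P[OF n] set_pmf_not_empty[of "V n"] by blast
      then have "\<phi> n v \<in> space (word_space MX n)"
        using jc[OF n] by (auto simp: joint_code_def)
      then have "channel_code MX MY n (M n) (\<lambda>_. \<phi> n v) (\<lambda>_. 1)"
        using M(1) by (rule constant_channel_code)
      then show ?thesis
        using False by blast
    qed
  qed auto
  then obtain e d where ed: "\<And>n. n \<ge> 1 \<Longrightarrow> channel_code MX MY n (M n) (e n) (d n) \<and>
      (\<eta> n < \<delta> / 2 \<and> \<delta> \<le> p n \<longrightarrow> average_error MY (W n) n (M n) (e n) (d n) \<le> \<eta> n)"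
    by metis
  have "\<forall>\<^sub>F n in sequentially. \<eta> n < \<delta> / 2"
    using \<eta>_lim \<delta> by (intro order_tendstoD) auto
  then have "\<forall>\<^sub>F n in sequentially. \<delta> \<le> p n \<longrightarrow> average_error MY (W n) n (M n) (e n) (d n) \<le> \<eta> n"
    using eventually_ge_at_top[of 1] by eventually_elim (use ed in auto)
  moreover have "ereal R \<le> liminf (rate M)"
    using \<delta> M(2) by (intro liminf_rate_ge[of "\<delta> / 2"]) auto
  ultimately show ?thesis
    using ed \<eta>_lim unfolding p_def by blast
qed

text \<open>
  A single message is sent without error. This makes every rate above the capacity positive, so that
  \<open>source_codes_for_probable_words\<close> applies to it.
\<close>

lemma capacity_nonneg:
  assumes "\<And>n. n \<ge> 1 \<Longrightarrow> space (word_space MX n) \<noteq> {}"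
  shows "0 \<le> capacity MX MY W"
proof -
  define x where "x n = (SOME z. z \<in> space (word_space MX n))" for n
  have x: "x n \<in> space (word_space MX n)" if "n \<ge> 1" for n
    unfolding x_def using assms[OF that] by (simp add: some_in_eq)
  have "(\<lambda>n. average_error MY (W n) n 1 (\<lambda>_. x n) (\<lambda>_. 1)) \<longlonglongrightarrow> 0"
    by (rule tendsto_eventually)
      (simp add: average_error_def message_error_def)
  moreover have "ereal 0 \<le> liminf (rate (\<lambda>_. 1))"
    by (rule liminf_rate_ge[of 1]) auto
  moreover have "\<forall>n\<ge>1. channel_code MX MY n 1 (\<lambda>_. x n) (\<lambda>_. 1)"
    using x constant_channel_code by blast
  ultimately have "channel_achievable MX MY W 0"
    unfolding channel_achievable_def
    by (intro exI[of _ "\<lambda>_. 1"] exI[of _ "\<lambda>n _. x n"] exI[of _ "\<lambda>_ _. 1"]) auto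
  then have "ereal 0 \<le> capacity MX MY W"
    unfolding capacity_def by (intro Sup_upper) auto
  then show ?thesis
    by (simp add: zero_ereal_def)
qed

lemma source_rate_le_capacity:
  assumes src: "general_source A V" and ch: "general_channel MX MY W"
    and sc: "source_strong_converse A V \<or> channel_strong_converse MX MY W"
    and tr: "transmissible A MX MY V W"
  shows "source_rate A V \<le> capacity MX MY W"
proof (rule ccontr)
  assume "\<not> source_rate A V \<le> capacity MX MY W"
  then obtain R where R: "capacity MX MY W < ereal R" "ereal R < source_rate A V"
    using ereal_dense2[of "capacity MX MY W" "source_rate A V"] by (auto simp: not_le)
  have "space (word_space MX n) \<noteq> {}" if n: "n \<ge> 1" for n
  proof -
    obtain \<phi> \<psi> where "joint_code A MX MY n \<phi> \<psi>"
      using tr n unfolding transmissible_def by blast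
    moreover obtain v where "v \<in> words A n"
      using src n set_pmf_not_empty[of "V n"] unfolding general_source_def by blast
    ultimately show ?thesis
      by (auto simp: joint_code_def)
  qed
  then have "0 \<le> capacity MX MY W"
    by (rule capacity_nonneg)
  then have "0 < ereal R"
    using R(1) by (rule le_less_trans)
  then have R_nonneg: "0 \<le> R"
    by simp
  define p where "p n = measure_pmf.prob (V n) {v. pmf (V n) v \<le> exp (- (real n * R))}" for n
  obtain M f g where source:
    "\<forall>n\<ge>1. source_code A n (M n) (f n) (g n)" "limsup (rate M) \<le> ereal R"
    "\<And>n. n \<ge> 1 \<Longrightarrow> source_error (V n) (f n) (g n) \<le> p n"
    using source_codes_for_probable_words[OF src R_nonneg] unfolding p_def by blast
  have error_le_p: "\<forall>\<^sub>F n in sequentially. source_error (V n) (f n) (g n) \<le> p n"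
    using eventually_ge_at_top[of 1] by eventually_elim (rule source(3))
  note channel = channel_codes_from_transmissibility[OF src ch tr, of _ R, folded p_def]
  from sc show False
  proof
    assume "source_strong_converse A V"
    then have "(\<lambda>n. source_error (V n) (f n) (g n)) \<longlonglongrightarrow> 1"
      using R(2) source unfolding source_strong_converse_def by blast
    then have "\<forall>\<^sub>F n in sequentially. 1 / 2 < source_error (V n) (f n) (g n)"
      by (rule order_tendstoD) simp
    then have p: "\<forall>\<^sub>F n in sequentially. 1 / 2 \<le> p n"
      using error_le_p by eventually_elim linarith
    obtain L e d \<eta> where L: "\<forall>n\<ge>1. channel_code MX MY n (L n) (e n) (d n)"
      "ereal R \<le> liminf (rate L)" "\<eta> \<longlonglongrightarrow> 0"
      "\<forall>\<^sub>F n in sequentially. 1 / 2 \<le> p n \<longrightarrow> average_error MY (W n) n (L n) (e n) (d n) \<le> \<eta> n"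
      using channel[of "1 / 2"] by auto
    have "(\<lambda>n. average_error MY (W n) n (L n) (e n) (d n)) \<longlonglongrightarrow> 0"
    proof (rule tendsto_sandwich[OF _ _ tendsto_const L(3)])
      show "\<forall>\<^sub>F n in sequentially. 0 \<le> average_error MY (W n) n (L n) (e n) (d n)"
        by (simp add: average_error_nonneg)
      show "\<forall>\<^sub>F n in sequentially. average_error MY (W n) n (L n) (e n) (d n) \<le> \<eta> n"
        using L(4) p by eventually_elim simp
    qed
    then have "channel_achievable MX MY W R"
      using L unfolding channel_achievable_def by blast
    then have "ereal R \<le> capacity MX MY W"
      unfolding capacity_def by (intro Sup_upper) auto
    then show False
      using R(1) by simp
  next
    assume strong: "channel_strong_converse MX MY W"
    have small: "\<forall>\<^sub>F n in sequentially. p n < \<delta>" if \<delta>: "0 < \<delta>" for \<delta>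
    proof -
      obtain L e d \<eta> where L: "\<forall>n\<ge>1. channel_code MX MY n (L n) (e n) (d n)"
        "ereal R \<le> liminf (rate L)" "\<eta> \<longlonglongrightarrow> 0"
        "\<forall>\<^sub>F n in sequentially. \<delta> \<le> p n \<longrightarrow> average_error MY (W n) n (L n) (e n) (d n) \<le> \<eta> n"
        using channel[OF \<delta>] by auto
      have "(\<lambda>n. average_error MY (W n) n (L n) (e n) (d n)) \<longlonglongrightarrow> 1"
        using strong R(1) L unfolding channel_strong_converse_def by blast
      then have "\<forall>\<^sub>F n in sequentially. 1 / 2 < average_error MY (W n) n (L n) (e n) (d n)"
        by (rule order_tendstoD) simp
      moreover have "\<forall>\<^sub>F n in sequentially. \<eta> n < 1 / 2"
        using L(3) by (rule order_tendstoD) simp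
      ultimately show ?thesis
        using L(4) by eventually_elim (meson less_trans not_le)
    qed
    have "(\<lambda>n. source_error (V n) (f n) (g n)) \<longlonglongrightarrow> 0"
    proof (rule order_tendstoI)
      fix \<delta> :: real
      assume "0 < \<delta>"
      from small[OF this] error_le_p
      show "\<forall>\<^sub>F n in sequentially. source_error (V n) (f n) (g n) < \<delta>"
        by eventually_elim linarith
    next
      fix \<delta> :: real
      assume "\<delta> < 0"
      then show "\<forall>\<^sub>F n in sequentially. \<delta> < source_error (V n) (f n) (g n)"
        by (simp add: source_error_def less_le_trans[OF _ measure_nonneg])
    qed
    then have "source_achievable A V R"
      using source unfolding source_achievable_def by blast
    then have "source_rate A V \<le> ereal R"
      unfolding source_rate_def by (intro Inf_lower) auto
    then show False
      using R(2) by simp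
  qed
qed


section \<open>Separation of source and channel coding\<close>

lemma two_step_transmissible_if_rate_less_capacity:
  assumes src: "general_source A V" and ch: "general_channel MX MY W"
    and less: "source_rate A V < capacity MX MY W"
  shows "two_step_transmissible A MX MY V W"
proof -
  obtain r s where rs: "source_achievable A V r" "channel_achievable MX MY W s" "r < s"
    using less unfolding source_rate_def capacity_def Inf_less_iff less_Sup_iff by auto
  obtain N f g where N: "\<And>n. n \<ge> 1 \<Longrightarrow> source_code A n (N n) (f n) (g n)"
    "(\<lambda>n. source_error (V n) (f n) (g n)) \<longlonglongrightarrow> 0" "limsup (rate N) \<le> ereal r"
    using rs(1) unfolding source_achievable_def by blast
  obtain L e d where L: "\<And>n. n \<ge> 1 \<Longrightarrow> channel_code MX MY n (L n) (e n) (d n)"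
    "(\<lambda>n. average_error MY (W n) n (L n) (e n) (d n)) \<longlonglongrightarrow> 0" "ereal s \<le> liminf (rate L)"
    using rs(2) unfolding channel_achievable_def by blast
  have P: "set_pmf (V n) \<subseteq> words A n" and K: "W n \<in> word_space MX n \<rightarrow>\<^sub>M prob_algebra (word_space MY n)"
    if "n \<ge> 1" for n
    using that src ch by (auto simp: general_source_def general_channel_def)
  have N1: "1 \<le> N n" and L1: "1 \<le> L n" if "n \<ge> 1" for n
    using N(1)[OF that] L(1)[OF that] by (auto simp: source_code_def channel_code_def)
  define a where "a n = 2 * average_error MY (W n) n (L n) (e n) (d n)" for n
  have "\<forall>\<^sub>F n in sequentially. 1 \<le> N n"
    using eventually_ge_at_top[of 1] by eventually_elim (rule N1)
  moreover have "\<forall>\<^sub>F n in sequentially. 1 \<le> L n"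
    using eventually_ge_at_top[of 1] by eventually_elim (rule L1)
  ultimately have fits: "\<forall>\<^sub>F n in sequentially. 2 * N n \<le> L n"
    by (rule eventually_double_le_of_rates[OF N(3) L(3) rs(3)])
  \<comment> \<open>The finitely many \<open>n\<close> at which the source code does not yet fit into the channel code only need
    some channel code with \<open>N n\<close> messages.\<close>
  have "\<exists>e' d'. n \<ge> 1 \<longrightarrow> channel_code MX MY n (N n) e' d' \<and>
          (2 * N n \<le> L n \<longrightarrow> (\<forall>i\<in>{1..N n}. message_error MY (W n) n e' d' i \<le> a n))" for n
  proof (cases "n \<ge> 1")
    case n: True
    show ?thesis
    proof (cases "2 * N n \<le> L n")
      case True
      then show ?thesis
        using expurgation[OF K[OF n] L(1)[OF n] N1[OF n] True] unfolding a_def by metis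
    next
      case False
      have "e n 1 \<in> space (word_space MX n)"
        using L(1)[OF n] by (auto simp: channel_code_def)
      then have "channel_code MX MY n (N n) (\<lambda>_. e n 1) (\<lambda>_. 1)"
        using N1[OF n] by (rule constant_channel_code)
      then show ?thesis
        using False by blast
    qed
  qed auto
  then obtain e' d' where cc: "\<And>n. n \<ge> 1 \<Longrightarrow> channel_code MX MY n (N n) (e' n) (d' n)"
    and small: "\<And>n i. n \<ge> 1 \<Longrightarrow> 2 * N n \<le> L n \<Longrightarrow> i \<in> {1..N n} \<Longrightarrow>
                  message_error MY (W n) n (e' n) (d' n) i \<le> a n"
    by metis
  have a_lim: "a \<longlonglongrightarrow> 0"
    unfolding a_def using tendsto_mult_right_zero[OF L(2), of 2] by simp
  have "(\<lambda>n. maximum_error MY (W n) n (N n) (e' n) (d' n)) \<longlonglongrightarrow> 0"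
  proof (rule tendsto_sandwich[OF _ _ tendsto_const a_lim])
    show "\<forall>\<^sub>F n in sequentially. 0 \<le> maximum_error MY (W n) n (N n) (e' n) (d' n)"
      using eventually_ge_at_top[of 1]
    proof eventually_elim
      case (elim n)
      have "0 \<le> message_error MY (W n) n (e' n) (d' n) 1"
        by (simp add: message_error_def)
      also have "\<dots> \<le> maximum_error MY (W n) n (N n) (e' n) (d' n)"
        unfolding maximum_error_def using N1[OF elim] by (intro Max_ge) auto
      finally show ?case .
    qed
    show "\<forall>\<^sub>F n in sequentially. maximum_error MY (W n) n (N n) (e' n) (d' n) \<le> a n"
      using fits eventually_ge_at_top[of 1]
    proof eventually_elim
      case (elim n)
      then show ?case
        unfolding maximum_error_def using N1[of n] small[of n] by (subst Max_le_iff) auto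
    qed
  qed
  moreover have "(\<lambda>n. joint_error A MY (V n) (W n) n (e' n \<circ> f n) (g n \<circ> d' n)) \<longlonglongrightarrow> 0"
  proof (rule tendsto_sandwich[OF _ _ tendsto_const])
    show "\<forall>\<^sub>F n in sequentially. 0 \<le> joint_error A MY (V n) (W n) n (e' n \<circ> f n) (g n \<circ> d' n)"
      unfolding joint_error_def by (intro always_eventually allI infsum_nonneg mult_nonneg_nonneg) auto
    show "\<forall>\<^sub>F n in sequentially. joint_error A MY (V n) (W n) n (e' n \<circ> f n) (g n \<circ> d' n)
            \<le> source_error (V n) (f n) (g n) + a n"
      using fits eventually_ge_at_top[of 1]
    proof eventually_elim
      case (elim n)
      then show ?case
        by (intro joint_error_concatenation[OF K P N(1) cc small]) auto
    qed
    show "(\<lambda>n. source_error (V n) (f n) (g n) + a n) \<longlonglongrightarrow> 0"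
      using tendsto_add[OF N(2) a_lim] by simp
  qed
  moreover have "\<forall>n\<ge>1. joint_code A MX MY n (e' n \<circ> f n) (g n \<circ> d' n)"
    using N(1) cc joint_code_concatenation by blast
  ultimately show ?thesis
    using N(1,2) cc unfolding two_step_transmissible_def
    by (intro exI[of _ N] exI[of _ f] exI[of _ g] exI[of _ e'] exI[of _ d']) simp
qed

lemma transmissible_if_two_step_transmissible:
  assumes "two_step_transmissible A MX MY V W"
  shows "transmissible A MX MY V W"
  using assms unfolding two_step_transmissible_def transmissible_def
  apply (elim exE conjE)
  subgoal for M f g e d
    by (intro exI[of _ "\<lambda>n. e n \<circ> f n"] exI[of _ "\<lambda>n. g n \<circ> d n"] conjI)
  done

theorem theorem6p5:
  fixes A :: "'v set"
    and MX :: "'x measure"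
    and MY :: "'y measure"
    and V :: "nat \<Rightarrow> (nat \<Rightarrow> 'v) pmf"
    and W :: "nat \<Rightarrow> (nat \<Rightarrow> 'x) \<Rightarrow> (nat \<Rightarrow> 'y) measure"
  assumes "general_source A V"
    and "general_channel MX MY W"
    and "source_strong_converse A V \<or> channel_strong_converse MX MY W"
  shows "(source_rate A V < capacity MX MY W \<longrightarrow>
            transmissible A MX MY V W \<and> two_step_transmissible A MX MY V W) \<and>
         (transmissible A MX MY V W \<longrightarrow> source_rate A V \<le> capacity MX MY W)"
  using source_rate_le_capacity[OF assms] two_step_transmissible_if_rate_less_capacity[OF assms(1,2)]
    transmissible_if_two_step_transmissible
  by blast

end
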